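(* Let $N=2^k\overline{N}$ with $k>1$ and $\overline{N}$ odd (positive), and suppose that $T_{2^{k-1}\overline{N}}\notin\mathcal{G}_N$ and $f_{1+2^{k-1}\overline{N}}\notin\mathcal{G}_N$. Then there are an integer $m$ and a group $H$ such that, as an internal product of subgroups, $$\mathcal{G}_N=\langle T_{2^{k-1}\overline{N}}\,f_{1+2^{k-1}\overline{N}}\rangle\times\big(\langle T_{2m}\rangle\rtimes H\big),$$ where $H$ is a proper subgroup of $U(\mathbb{Z}_N)$ (identified with $\{f_\nu:\nu\in U(\mathbb{Z}_N)\}$) and $\langle T_{2m}\rangle$ is a proper subgroup of $\langle T_2\rangle$.
   Context: Let $N=2n$ be an even positive integer. For $k\in\mathbb{Z}_N$ let $T_k(x)=x+k$ and for a unit $\nu\in U(\mathbb{Z}_N)$ let $f_\nu(x)=\nu x$ on $\mathbb{Z}_N$; products are compositions. Let $D_n=\langle\rho,\sigma\mid\rho^n=\sigma^2=1,\ \rho^k\sigma=\sigma\rho^{-k}\rangle$ act on $\mathbb{Z}_{N}$ by $\rho^k\cdot x=x+2k$, $\sigma\cdot x=-x$. $\widehat{Aut(D_n)}$ denotes the group of all bijections $f$ of $\mathbb{Z}_N$ for which there is $\phi\in Aut(D_n)$ with $f(g\cdot x)=\phi(g)\cdot f(x)$ for all $g\in D_n$, $x\in\mathbb{Z}_N$; it is the group of all affine maps $T_kf_\nu$ ($k\in\mathbb{Z}_N$, $\nu\in U(\mathbb{Z}_N)$). Dihedral sieve: let $p$ range over $2$ and the odd primes $p\le\sqrt N$ dividing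 $N$, and let $q$ range over the primes $q\le \sqrt N$ not dividing $N$. Set $$\mathcal{A}_N=\bigcup_{p}\{kp : k\in\mathbb{Z}\}\ \cup\ \bigcup_{q}\{\pm jq : 2\le j\le \lfloor N/q\rfloor\}\subseteq\mathbb{Z}_N,$$ and let $\overline{\mathcal{A}_N}$ be the complement of $\mathcal{A}_N$ in $\mathbb{Z}_N$. (These are unions of orbits of suitable dihedral groups; the sieve is the partition $\mathcal{C}_N=\{\mathcal{A}_N,\overline{\mathcal{A}_N}\}$.) Define $$\mathcal{G}_N=\{f\in\widehat{Aut(D_{n})} : f(\mathcal{A}_N)=\mathcal{A}_N\}.$$ *)

theory Defs
  imports "HOL-Algebra.Group_Action" "HOL-Number_Theory.Residues"
begin

section \<open>Affine maps of the integers modulo N\<close>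

abbreviation ZN :: "nat \<Rightarrow> int set" where
  "ZN N \<equiv> carrier (residue_ring (int N))"

abbreviation UZN :: "nat \<Rightarrow> int set" where
  "UZN N \<equiv> Units (residue_ring (int N))"

text \<open>Maps are extensional on \<open>ZN N\<close>, as required by \<open>Bij\<close> and \<open>BijGroup\<close>. The parameters
  \<open>c\<close> and \<open>u\<close> are arbitrary integers and only matter modulo \<open>N\<close>.\<close>

definition transl :: "nat \<Rightarrow> int \<Rightarrow> int \<Rightarrow> int" where
  "transl N c = (\<lambda>x \<in> ZN N. (x + c) mod int N)"

definition scal :: "nat \<Rightarrow> int \<Rightarrow> int \<Rightarrow> int" where
  "scal N u = (\<lambda>x \<in> ZN N. (u * x) mod int N)"


section \<open>The dihedral group and its action\<close>

text \<open>The standard model of the group of order \<open>2 n\<close> presented by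
  \<open>\<rho>\<^sup>n = \<sigma>\<^sup>2 = 1\<close>, \<open>\<rho>\<^sup>k \<sigma> = \<sigma> \<rho>\<^sup>-\<^sup>k\<close>: the pair \<open>(i, a)\<close> stands for \<open>\<rho>\<^sup>i\<close> if \<open>a\<close> is false and for
  \<open>\<rho>\<^sup>i \<sigma>\<close> if \<open>a\<close> is true. The lemmas below show that it is a group of that order generated by
  elements satisfying these relations.\<close>

definition dihedral :: "nat \<Rightarrow> (int \<times> bool) monoid" where
  "dihedral n =
    \<lparr>carrier = {0..<int n} \<times> UNIV,
     monoid.mult = (\<lambda>(i, a) (j, b). ((i + (if a then - j else j)) mod int n, a \<noteq> b)),
     one = (0, False)\<rparr>"

definition rho :: "nat \<Rightarrow> int \<times> bool" where
  "rho n = (1 mod int n, False)"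

definition sigma :: "int \<times> bool" where
  "sigma = (0, True)"

text \<open>\<open>\<rho>\<^sup>i \<cdot> x = x + 2 i\<close> and \<open>\<rho>\<^sup>i \<sigma> \<cdot> x = - x + 2 i\<close> on the integers modulo \<open>2 n\<close>.\<close>

definition dihedral_act :: "nat \<Rightarrow> int \<times> bool \<Rightarrow> int \<Rightarrow> int" where
  "dihedral_act n = (\<lambda>(i, a). \<lambda>x \<in> ZN (2 * n). ((if a then - x else x) + 2 * i) mod int (2 * n))"

definition Aut_hat :: "nat \<Rightarrow> (int \<Rightarrow> int) set" where
  "Aut_hat n = {f \<in> Bij (ZN (2 * n)).
     \<exists>\<phi> \<in> auto (dihedral n). \<forall>g \<in> carrier (dihedral n). \<forall>x \<in> ZN (2 * n).
       f (dihedral_act n g x) = dihedral_act n (\<phi> g) (f x)}"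

lemma ZN_iff: "x \<in> carrier (residue_ring m) \<longleftrightarrow> 0 \<le> x \<and> x < m"
  by (auto simp: residue_ring_def)

lemma dihedral_simps:
  "carrier (dihedral n) = {0..<int n} \<times> UNIV"
  "(i, a) \<otimes>\<^bsub>dihedral n\<^esub> (j, b) = ((i + (if a then - j else j)) mod int n, a \<noteq> b)"
  "\<one>\<^bsub>dihedral n\<^esub> = (0, False)"
  by (simp_all add: dihedral_def)

lemma group_dihedral:
  assumes "n > 0"
  shows "group (dihedral n)"
proof (rule groupI)
  fix x y assume "x \<in> carrier (dihedral n)" "y \<in> carrier (dihedral n)"
  then show "x \<otimes>\<^bsub>dihedral n\<^esub> y \<in> carrier (dihedral n)"
    using assms by (cases x, cases y) (simp add: dihedral_simps)
next
  show "\<one>\<^bsub>dihedral n\<^esub> \<in> carrier (dihedral n)"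
    using assms by (simp add: dihedral_simps)
next
  fix x y z :: "int \<times> bool"
  obtain i a j b k c where "x = (i, a)" "y = (j, b)" "z = (k, c)"
    by (cases x, cases y, cases z)
  then show "x \<otimes>\<^bsub>dihedral n\<^esub> y \<otimes>\<^bsub>dihedral n\<^esub> z = x \<otimes>\<^bsub>dihedral n\<^esub> (y \<otimes>\<^bsub>dihedral n\<^esub> z)"
    by (cases a; cases b; cases c) (simp_all add: dihedral_simps mod_simps algebra_simps)
next
  fix x assume "x \<in> carrier (dihedral n)"
  then show "\<one>\<^bsub>dihedral n\<^esub> \<otimes>\<^bsub>dihedral n\<^esub> x = x"
    by (cases x) (simp add: dihedral_simps)
next
  fix x assume x: "x \<in> carrier (dihedral n)"
  obtain i a where xi: "x = (i, a)" by (cases x)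
  let ?y = "if a then (i, a) else ((- i) mod int n, a)"
  have "?y \<in> carrier (dihedral n)" "?y \<otimes>\<^bsub>dihedral n\<^esub> x = \<one>\<^bsub>dihedral n\<^esub>"
    using x assms by (auto simp: dihedral_simps xi mod_simps)
  then show "\<exists>y\<in>carrier (dihedral n). y \<otimes>\<^bsub>dihedral n\<^esub> x = \<one>\<^bsub>dihedral n\<^esub>" by blast
qed

lemma card_dihedral: "card (carrier (dihedral n)) = 2 * n"
  by (simp add: dihedral_simps card_cartesian_product)

lemma dihedral_gens_in_carrier:
  assumes "n > 0"
  shows "rho n \<in> carrier (dihedral n)" "sigma \<in> carrier (dihedral n)"
  using assms by (auto simp: dihedral_simps rho_def sigma_def)

lemma rho_pow: "rho n [^]\<^bsub>dihedral n\<^esub> (k::nat) = (int k mod int n, False)"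
proof (induction k)
  case 0
  then show ?case by (simp add: nat_pow_def dihedral_simps)
next
  case (Suc k)
  have "rho n [^]\<^bsub>dihedral n\<^esub> Suc k = rho n [^]\<^bsub>dihedral n\<^esub> k \<otimes>\<^bsub>dihedral n\<^esub> rho n"
    by (simp add: nat_pow_def)
  also have "\<dots> = (int k mod int n, False) \<otimes>\<^bsub>dihedral n\<^esub> rho n"
    unfolding Suc ..
  finally show ?case
    by (simp add: rho_def dihedral_simps mod_simps add.commute)
qed

lemma dihedral_elem:
  assumes "(i, a) \<in> carrier (dihedral n)"
  shows "(i, a) = rho n [^]\<^bsub>dihedral n\<^esub> nat i \<otimes>\<^bsub>dihedral n\<^esub> (if a then sigma else \<one>\<^bsub>dihedral n\<^esub>)"
  using assms unfolding rho_pow by (cases a) (simp_all add: dihedral_simps sigma_def)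

lemma dihedral_relations:
  assumes "n > 0"
  shows "rho n [^]\<^bsub>dihedral n\<^esub> n = \<one>\<^bsub>dihedral n\<^esub>"
    and "sigma \<otimes>\<^bsub>dihedral n\<^esub> sigma = \<one>\<^bsub>dihedral n\<^esub>"
    and "rho n [^]\<^bsub>dihedral n\<^esub> (k::nat) \<otimes>\<^bsub>dihedral n\<^esub> sigma =
         sigma \<otimes>\<^bsub>dihedral n\<^esub> inv\<^bsub>dihedral n\<^esub> (rho n [^]\<^bsub>dihedral n\<^esub> k)"
proof -
  interpret group "dihedral n" by (rule group_dihedral[OF assms])
  show "rho n [^]\<^bsub>dihedral n\<^esub> n = \<one>\<^bsub>dihedral n\<^esub>"
    unfolding rho_pow by (simp add: dihedral_simps)
  show "sigma \<otimes>\<^bsub>dihedral n\<^esub> sigma = \<one>\<^bsub>dihedral n\<^esub>"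
    by (simp add: dihedral_simps sigma_def)
  have "inv\<^bsub>dihedral n\<^esub> (int k mod int n, False) = ((- int k) mod int n, False)"
    by (rule inv_equality) (use assms in \<open>simp_all add: dihedral_simps mod_simps\<close>)
  then show "rho n [^]\<^bsub>dihedral n\<^esub> (k::nat) \<otimes>\<^bsub>dihedral n\<^esub> sigma =
      sigma \<otimes>\<^bsub>dihedral n\<^esub> inv\<^bsub>dihedral n\<^esub> (rho n [^]\<^bsub>dihedral n\<^esub> k)"
    unfolding rho_pow by (simp add: dihedral_simps sigma_def mod_simps)
qed

lemma dihedral_act_in:
  assumes "n > 0" "x \<in> ZN (2 * n)"
  shows "dihedral_act n g x \<in> ZN (2 * n)"
  using assms by (cases g) (simp add: dihedral_act_def ZN_iff)

lemma dihedral_act_mult: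
  assumes "n > 0" "x \<in> ZN (2 * n)"
  shows "dihedral_act n (g \<otimes>\<^bsub>dihedral n\<^esub> h) x = dihedral_act n g (dihedral_act n h x)"
proof -
  obtain i a j b where gh: "g = (i, a)" "h = (j, b)" by (cases g, cases h)
  define m where "m = 2 * int n"
  have red: "(s + 2 * (t mod int n)) mod m = (s + 2 * t) mod m" for s t
    unfolding m_def mult_mod_right by (rule mod_add_right_eq)
  have act: "dihedral_act n (k, c) y = ((if c then - y else y) + 2 * k) mod m"
    if "0 \<le> y" "y < m" for k c y
    using that by (simp add: dihedral_act_def ZN_iff m_def)
  have x: "0 \<le> x" "x < m"
    using assms by (simp_all add: ZN_iff m_def)
  have pos: "0 \<le> t mod m" "t mod m < m" for t
    using assms by (simp_all add: m_def)
  have neg: "(- (t mod m) + s) mod m = (- t + s) mod m" for s t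
    by (metis mod_add_left_eq mod_minus_eq)
  have left: "(t mod m + s) mod m = (t + s) mod m" for s t
    by (rule mod_add_left_eq)
  show ?thesis
    by (cases a; cases b)
       (simp_all only: gh dihedral_simps act x pos red neg left if_True if_False simp_thms,
        simp_all add: algebra_simps)
qed

lemma dihedral_act_one:
  assumes "x \<in> ZN (2 * n)"
  shows "dihedral_act n \<one>\<^bsub>dihedral n\<^esub> x = x"
  using assms by (simp add: dihedral_act_def dihedral_simps ZN_iff)

lemma dihedral_group_action:
  assumes "n > 0"
  shows "group_action (dihedral n) (ZN (2 * n)) (dihedral_act n)"
proof -
  interpret group "dihedral n" by (rule group_dihedral[OF assms])
  have bij: "dihedral_act n g \<in> Bij (ZN (2 * n))" if g: "g \<in> carrier (dihedral n)" for g
  proof -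
    have 1: "dihedral_act n (inv\<^bsub>dihedral n\<^esub> g) (dihedral_act n g x) = x"
      and 2: "dihedral_act n g (dihedral_act n (inv\<^bsub>dihedral n\<^esub> g) x) = x"
      if "x \<in> ZN (2 * n)" for x
      unfolding dihedral_act_mult[OF assms that, symmetric]
      using that g by (simp_all only: l_inv r_inv dihedral_act_one)
    have "bij_betw (dihedral_act n g) (ZN (2 * n)) (ZN (2 * n))"
      by (rule bij_betwI[where g = "dihedral_act n (inv\<^bsub>dihedral n\<^esub> g)"])
         (use 1 2 dihedral_act_in[OF assms] in blast)+
    moreover have "dihedral_act n g \<in> extensional (ZN (2 * n))"
      by (cases g) (simp add: dihedral_act_def)
    ultimately show ?thesis by (simp add: Bij_def)
  qed
  have mult: "dihedral_act n (g \<otimes>\<^bsub>dihedral n\<^esub> h) =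
      dihedral_act n g \<otimes>\<^bsub>BijGroup (ZN (2 * n))\<^esub> dihedral_act n h"
    if "g \<in> carrier (dihedral n)" "h \<in> carrier (dihedral n)" for g h
  proof (rule extensionalityI[where A = "ZN (2 * n)"])
    show "dihedral_act n (g \<otimes>\<^bsub>dihedral n\<^esub> h) \<in> extensional (ZN (2 * n))"
      using bij[OF m_closed[OF that]] by (rule Bij_imp_extensional)
    have eq: "dihedral_act n g \<otimes>\<^bsub>BijGroup (ZN (2 * n))\<^esub> dihedral_act n h =
        compose (ZN (2 * n)) (dihedral_act n g) (dihedral_act n h)"
      unfolding BijGroup_def using bij[OF that(1)] bij[OF that(2)] by simp
    show "dihedral_act n g \<otimes>\<^bsub>BijGroup (ZN (2 * n))\<^esub> dihedral_act n h \<in> extensional (ZN (2 * n))"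
      unfolding eq by (rule compose_extensional)
    show "dihedral_act n (g \<otimes>\<^bsub>dihedral n\<^esub> h) x =
        (dihedral_act n g \<otimes>\<^bsub>BijGroup (ZN (2 * n))\<^esub> dihedral_act n h) x"
      if "x \<in> ZN (2 * n)" for x
      unfolding eq dihedral_act_mult[OF assms that] by (rule compose_eq[OF that, symmetric])
  qed
  have "dihedral_act n \<in> hom (dihedral n) (BijGroup (ZN (2 * n)))"
  proof (rule homI)
    show "dihedral_act n g \<in> carrier (BijGroup (ZN (2 * n)))" if "g \<in> carrier (dihedral n)" for g
      using bij[OF that] by (simp add: BijGroup_def)
  qed (rule mult)
  then show ?thesis
    by (intro group_action.intro group_hom.intro group_hom_axioms.intro group_BijGroup is_group)
qed


section \<open>The dihedral sieve\<close>

definition sieve_set :: "nat \<Rightarrow> int set" where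
  "sieve_set N =
    (\<Union>p \<in> {p::nat. p = 2 \<or> prime p \<and> odd p \<and> real p \<le> sqrt (real N) \<and> p dvd N}.
       {(k * int p) mod int N | k::int. True}) \<union>
    (\<Union>q \<in> {q::nat. prime q \<and> real q \<le> sqrt (real N) \<and> \<not> q dvd N}.
       {(s * int j * int q) mod int N | (s::int) (j::nat).
          s \<in> {1, - 1} \<and> 2 \<le> j \<and> int j \<le> \<lfloor>real N / real q\<rfloor>})"

text \<open>Only meaningful for even \<open>N\<close>, where \<open>N = 2 * (N div 2)\<close>.\<close>

definition sieve_group :: "nat \<Rightarrow> (int \<Rightarrow> int) set" where
  "sieve_group N = {f \<in> Aut_hat (N div 2). f ` sieve_set N = sieve_set N}"


section \<open>Internal products of subgroups\<close>

text \<open>\<open>K = A \<times> B\<close> and \<open>K = A \<rtimes> B\<close> (with \<open>A\<close> the normal factor) for subgroups of \<open>G\<close>.\<close>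

definition internal_direct ::
    "('a, 'b) monoid_scheme \<Rightarrow> 'a set \<Rightarrow> 'a set \<Rightarrow> 'a set \<Rightarrow> bool" where
  "internal_direct G K A B \<longleftrightarrow>
     subgroup K G \<and> A \<lhd> G\<lparr>carrier := K\<rparr> \<and> B \<lhd> G\<lparr>carrier := K\<rparr> \<and>
     A \<inter> B = {\<one>\<^bsub>G\<^esub>} \<and> K = A <#>\<^bsub>G\<^esub> B"

definition internal_semidirect ::
    "('a, 'b) monoid_scheme \<Rightarrow> 'a set \<Rightarrow> 'a set \<Rightarrow> 'a set \<Rightarrow> bool" where
  "internal_semidirect G K A B \<longleftrightarrow>
     subgroup K G \<and> A \<lhd> G\<lparr>carrier := K\<rparr> \<and> subgroup B (G\<lparr>carrier := K\<rparr>) \<and>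
     A \<inter> B = {\<one>\<^bsub>G\<^esub>} \<and> K = A <#>\<^bsub>G\<^esub> B"

end

theory Submission
  imports Defs
begin

text \<open>Write \<open>M = N / 2\<close>, which is even because \<open>4\<close> divides \<open>N\<close>, and \<open>T\<^sub>c f\<^sub>u\<close> for the map
  \<open>x \<mapsto> u x + c\<close>. The equivariant bijections are exactly the affine maps
  (\<open>Aut_hat_imp_affine\<close>, \<open>affine_in_Aut_hat\<close>), so the group \<open>\<G>\<close> in question is the stabilizer, among
  all affine maps, of the sieve set \<open>A\<close>. The argument rests on two features of \<open>A\<close>: it contains all
  even residues and it is closed under negation.

  The map \<open>\<tau> = T\<^sub>M f\<^bsub>1 + M\<^esub>\<close> fixes every odd residue and adds \<open>M\<close> to every even one. Hence it
  stabilizes \<open>A\<close>, has order two, and commutes with every affine map of even translation part. The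
  hypothesis \<open>T\<^sub>M \<notin> \<G>\<close> has two consequences. A stabilizing map with odd translation part would
  exchange the parities and force \<open>A\<close> to be everything, so all translation parts are even
  (\<open>stab_imp_even\<close>) and \<open>\<tau>\<close> is central. Moreover the translations in \<open>\<G>\<close> are the multiples of some
  even \<open>t\<close> dividing \<open>N = 2 M\<close> but not \<open>M\<close>.

  The crux is that an element \<open>T\<^sub>c f\<^sub>u\<close> of \<open>\<G>\<close> splits into its two parts up to \<open>\<tau>\<close>
  (\<open>stab_split\<close>). Since \<open>f\<^bsub>-1\<^esub>\<close> lies in \<open>\<G>\<close>, comparing \<open>T\<^sub>c f\<^sub>u\<close> with its conjugate
  \<open>T\<^bsub>-c\<^esub> f\<^sub>u\<close> shows \<open>T\<^bsub>2c\<^esub> \<in> \<G>\<close>, that is, \<open>t\<close> divides \<open>2 c\<close>. Either \<open>t\<close> divides \<open>c\<close>, and then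
  \<open>T\<^sub>c\<close> and \<open>f\<^sub>u\<close> are both in \<open>\<G>\<close>; or \<open>c\<close> and \<open>M\<close> are both odd multiples of \<open>t / 2\<close>, so \<open>t\<close>
  divides \<open>M + c\<close>, and the same applies to \<open>\<tau> T\<^sub>c f\<^sub>u\<close>, whose translation part is \<open>M + c\<close>. With
  \<open>H = {u. f\<^sub>u \<in> \<G>}\<close> and \<open>K = \<langle>T\<^sub>t\<rangle> H\<close> this says \<open>\<G> = {1, \<tau>} K\<close>. The hypothesis
  \<open>f\<^bsub>1 + M\<^esub> \<notin> \<G>\<close> makes \<open>H\<close> proper and keeps \<open>\<tau>\<close> out of \<open>K\<close>.\<close>

section \<open>Affine maps of the integers modulo N\<close>

definition aff :: "nat \<Rightarrow> int \<Rightarrow> int \<Rightarrow> int \<Rightarrow> int" where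
  "aff N c u = (\<lambda>x \<in> ZN N. (u * x + c) mod int N)"

lemma transl_eq_aff: "transl N c = aff N c 1"
  by (simp add: transl_def aff_def)

lemma scal_eq_aff: "scal N u = aff N 0 u"
  by (simp add: scal_def aff_def)

lemma aff_apply: "0 \<le> x \<Longrightarrow> x < int N \<Longrightarrow> aff N c u x = (u * x + c) mod int N"
  by (simp add: aff_def ZN_iff)

lemma aff_cong:
  assumes "[c = c'] (mod int N)" "[u = u'] (mod int N)"
  shows "aff N c u = aff N c' u'"
proof -
  have "[u * x + c = u' * x + c'] (mod int N)" for x
    using assms by (intro cong_add cong_mult) auto
  then show ?thesis by (simp add: aff_def cong_def)
qed

lemma affine_mod_arg: "(u * (t mod m) + s) mod m = (u * t + s) mod m" for u t s m :: int
  by (metis mod_add_left_eq mod_mult_right_eq)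

locale residue_affine =
  fixes N :: nat
  assumes N_gt_1: "N > 1"
begin

abbreviation G where "G \<equiv> BijGroup (ZN N)"

sublocale group G by (rule group_BijGroup)

lemma aff_eq_iff:
  "aff N c u = aff N c' u' \<longleftrightarrow> [c = c'] (mod int N) \<and> [u = u'] (mod int N)"
proof
  assume eq: "aff N c u = aff N c' u'"
  have c: "[c = c'] (mod int N)"
    using fun_cong[OF eq, of 0] N_gt_1 by (simp add: aff_apply cong_def)
  have "[u + c = u' + c'] (mod int N)"
    using fun_cong[OF eq, of 1] N_gt_1 by (simp add: aff_apply cong_def)
  then have "[(u + c) - c = (u' + c') - c'] (mod int N)"
    using c by (rule cong_diff)
  with c show "[c = c'] (mod int N) \<and> [u = u'] (mod int N)" by simp
qed (auto intro: aff_cong)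

lemma aff_range: "0 \<le> x \<Longrightarrow> x < int N \<Longrightarrow> 0 \<le> aff N c u x \<and> aff N c u x < int N"
  using N_gt_1 by (simp add: aff_apply)

lemma compose_aff: "compose (ZN N) (aff N c u) (aff N d v) = aff N (u * d + c) (u * v)"
proof
  fix x
  have "(u * ((v * x + d) mod int N) + c) mod int N = (u * v * x + (u * d + c)) mod int N"
    by (simp add: affine_mod_arg) (simp add: algebra_simps)
  then show "compose (ZN N) (aff N c u) (aff N d v) x = aff N (u * d + c) (u * v) x"
    using aff_range[of x d v] by (auto simp: compose_def ZN_iff aff_apply) (simp add: aff_def ZN_iff)+
qed

lemma one_eq_aff: "\<one>\<^bsub>G\<^esub> = aff N 0 1"
  by (auto simp: BijGroup_def aff_def ZN_iff restrict_def)

lemma ex_inverse: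
  assumes "coprime u (int N)"
  obtains v where "[u * v = 1] (mod int N)"
  using cong_solve_coprime_int[OF assms] by auto

lemma inverse_coprime: "[u * v = 1] (mod int N) \<Longrightarrow> coprime v (int N)"
  by (metis coprime_iff_invertible_int mult.commute)

lemma aff_Bij:
  assumes "coprime u (int N)"
  shows "aff N c u \<in> Bij (ZN N)"
proof -
  obtain v where v: "[u * v = 1] (mod int N)" using ex_inverse[OF assms] .
  have id: "compose (ZN N) (aff N c u) (aff N (- v * c) v) = aff N 0 1"
    "compose (ZN N) (aff N (- v * c) v) (aff N c u) = aff N 0 1"
  proof -
    have "[u * v * c = 1 * c] (mod int N)" using v by (rule cong_mult) simp
    then have "[c - u * v * c = c - c] (mod int N)" by (intro cong_diff) simp_all
    then show "compose (ZN N) (aff N c u) (aff N (- v * c) v) = aff N 0 1"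
      unfolding compose_aff using v by (intro aff_cong) (simp_all add: algebra_simps)
    show "compose (ZN N) (aff N (- v * c) v) (aff N c u) = aff N 0 1"
      unfolding compose_aff using v by (intro aff_cong) (simp_all add: algebra_simps)
  qed
  have pt: "aff N 0 1 x = x" if "x \<in> ZN N" for x
    using that by (simp add: aff_def ZN_iff)
  have "bij_betw (aff N c u) (ZN N) (ZN N)"
  proof (rule bij_betwI[where g = "aff N (- v * c) v"])
    show "aff N c u \<in> ZN N \<rightarrow> ZN N" "aff N (- v * c) v \<in> ZN N \<rightarrow> ZN N"
      using aff_range by (auto simp: ZN_iff)
    fix x assume x: "x \<in> ZN N"
    show "aff N (- v * c) v (aff N c u x) = x"
      using fun_cong[OF id(2), of x] pt[OF x] by (simp add: compose_eq[OF x])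
    show "aff N c u (aff N (- v * c) v x) = x"
      using fun_cong[OF id(1), of x] pt[OF x] by (simp add: compose_eq[OF x])
  qed
  then show ?thesis by (simp add: Bij_def aff_def)
qed

lemma coprime_if_aff_Bij:
  assumes "aff N c u \<in> Bij (ZN N)"
  shows "coprime u (int N)"
proof (rule ccontr)
  assume "\<not> coprime u (int N)"
  define g where "g = gcd u (int N)"
  have g: "g > 1" "g dvd u" "g dvd int N"
  proof -
    have "g \<noteq> 1" using \<open>\<not> coprime u (int N)\<close> by (simp add: g_def coprime_iff_gcd_eq_1)
    moreover have "g > 0" using N_gt_1 by (simp add: g_def)
    ultimately show "g > 1" by linarith
  qed (simp_all add: g_def)
  obtain a b where ab: "int N = g * a" "u = g * b" using g(2,3) by (metis dvdE)
  have a: "0 < a" "a < int N"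
  proof -
    show "0 < a" using ab(1) g(1) N_gt_1 by (metis of_nat_0_less_iff zero_less_mult_pos gr0I
        less_trans zero_less_one not_one_less_zero)
    then show "a < int N" using ab(1) g(1) by simp
  qed
  have "aff N c u a = aff N c u 0"
  proof -
    have "(u * a + c) mod int N = (c + int N * b) mod int N"
      by (simp add: ab algebra_simps)
    also have "\<dots> = c mod int N" by (rule mod_mult_self2)
    finally show ?thesis using a by (simp add: aff_apply)
  qed
  moreover have "inj_on (aff N c u) (ZN N)"
    using assms by (simp add: Bij_def bij_betw_def)
  ultimately show False
    using a by (auto dest!: inj_onD simp: ZN_iff)
qed

lemma aff_carrier: "coprime u (int N) \<Longrightarrow> aff N c u \<in> carrier G"
  by (simp add: BijGroup_def aff_Bij)

lemma aff_mult:
  assumes "coprime u (int N)" "coprime v (int N)"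
  shows "aff N c u \<otimes>\<^bsub>G\<^esub> aff N d v = aff N (u * d + c) (u * v)"
  using aff_Bij[OF assms(1), of c] aff_Bij[OF assms(2), of d]
  by (simp add: BijGroup_def compose_aff)

lemma aff_inv:
  assumes "[u * v = 1] (mod int N)"
  shows "inv\<^bsub>G\<^esub> (aff N c u) = aff N (- v * c) v"
proof (rule inv_equality)
  have u: "coprime u (int N)"
    using assms inverse_coprime[of v u] by (simp add: mult.commute)
  have v: "coprime v (int N)" using assms by (rule inverse_coprime)
  show "aff N (- v * c) v \<otimes>\<^bsub>G\<^esub> aff N c u = \<one>\<^bsub>G\<^esub>"
    unfolding aff_mult[OF v u] one_eq_aff
    by (rule aff_cong) (use assms in \<open>simp_all add: mult.commute\<close>)
qed (use assms inverse_coprime[of v u] inverse_coprime[of u v] aff_carrier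
      in \<open>simp_all add: mult.commute\<close>)

text \<open>The larger subgroups below are given by a condition on the parameters \<open>(c, u)\<close>. For these the
  subgroup laws reduce to arithmetic in the parameters, without reference to maps.\<close>

lemma aff_subgroup:
  assumes coprime: "\<And>c u. P c u \<Longrightarrow> coprime u (int N)"
    and one: "P 0 1"
    and mult: "\<And>c u d v. P c u \<Longrightarrow> P d v \<Longrightarrow> P (u * d + c) (u * v)"
    and inverse: "\<And>c u v. P c u \<Longrightarrow> [u * v = 1] (mod int N) \<Longrightarrow> P (- v * c) v"
  shows "subgroup {aff N c u | c u. P c u} G"
proof (rule subgroupI)
  show "{aff N c u | c u. P c u} \<subseteq> carrier G"
    using coprime aff_carrier by auto
  show "{aff N c u | c u. P c u} \<noteq> {}" using one by auto
next
  fix a assume "a \<in> {aff N c u | c u. P c u}"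
  then obtain c u where a: "a = aff N c u" "P c u" by auto
  obtain v where v: "[u * v = 1] (mod int N)" using ex_inverse[OF coprime[OF a(2)]] .
  show "inv\<^bsub>G\<^esub> a \<in> {aff N c u | c u. P c u}"
    using inverse[OF a(2) v] aff_inv[OF v, of c] a(1) by auto
next
  fix a b assume "a \<in> {aff N c u | c u. P c u}" "b \<in> {aff N c u | c u. P c u}"
  then obtain c u d v where ab: "a = aff N c u" "P c u" "b = aff N d v" "P d v" by auto
  then show "a \<otimes>\<^bsub>G\<^esub> b \<in> {aff N c u | c u. P c u}"
    using mult[OF ab(2,4)] aff_mult[OF coprime[OF ab(2)] coprime[OF ab(4)], of c d] by auto
qed

lemma aff_conj:
  assumes "coprime u (int N)" "coprime v (int N)"
  shows "aff N c u \<otimes>\<^bsub>G\<^esub> aff N d v \<otimes>\<^bsub>G\<^esub> inv\<^bsub>G\<^esub> (aff N c u) = aff N (c + u * d - v * c) v"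
proof (rule inv_solve_right'[THEN iffD2])
  show "aff N c u \<otimes>\<^bsub>G\<^esub> aff N d v = aff N (c + u * d - v * c) v \<otimes>\<^bsub>G\<^esub> aff N c u"
    unfolding aff_mult[OF assms] aff_mult[OF assms(2,1)]
    by (rule aff_cong) (simp_all add: algebra_simps)
qed (use assms aff_carrier aff_mult in auto)

lemma translation_subgroup:
  "subgroup {aff N c u | c u. [u = 1] (mod int N) \<and> d dvd c} G"
proof (rule aff_subgroup)
  fix c u v :: int
  assume *: "[u = 1] (mod int N) \<and> d dvd c" "[u * v = 1] (mod int N)"
  have "[u * v = 1 * v] (mod int N)" using *(1) by (intro cong_mult) auto
  with *(2) have "[v = 1] (mod int N)" by (metis cong_sym cong_trans mult_1)
  with *(1) show "[v = 1] (mod int N) \<and> d dvd - v * c" by simp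
next
  fix c u assume "[u = 1] (mod int N) \<and> d dvd c"
  then show "coprime u (int N)" by (metis coprime_1_left cong_imp_coprime cong_sym)
next
  fix c u e v assume "[u = 1] (mod int N) \<and> d dvd c" "[v = 1] (mod int N) \<and> d dvd e"
  then show "[u * v = 1] (mod int N) \<and> d dvd u * e + c"
    using cong_mult[of u 1 "int N" v 1] by simp
qed simp

text \<open>When \<open>d\<close> does not divide \<open>N\<close>, divisibility by \<open>d\<close> is not a condition on residues: the right
  hand side then asks for some representative \<open>c\<close> of the translation part to be a multiple of \<open>d\<close>.\<close>

lemma generate_transl:
  "generate G {transl N d} = {aff N c u | c u. [u = 1] (mod int N) \<and> d dvd c}" (is "_ = ?T")
proof
  have "transl N d \<in> ?T" unfolding transl_eq_aff by (intro CollectI exI[of _ d] exI[of _ 1]) simp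
  then show "generate G {transl N d} \<subseteq> ?T"
    using translation_subgroup by (intro generate_subgroup_incl) auto
  have nat_mult: "aff N (d * int j) 1 \<in> generate G {transl N d}" for j
  proof (induction j)
    case 0
    then show ?case using generate.one[of G] by (simp add: one_eq_aff)
  next
    case (Suc j)
    have "transl N d \<in> generate G {transl N d}" by (simp add: generate.incl)
    then have "aff N (d * int j) 1 \<otimes>\<^bsub>G\<^esub> aff N d 1 \<in> generate G {transl N d}"
      using Suc by (auto intro: generate.eng simp: transl_eq_aff)
    then show ?case by (simp add: aff_mult algebra_simps)
  qed
  show "?T \<subseteq> generate G {transl N d}"
  proof
    fix f assume "f \<in> ?T"
    then obtain j u where f: "f = aff N (d * j) u" "[u = 1] (mod int N)" by (auto elim!: dvdE)
    have "aff N (d * j) u = aff N (d * int (nat (j mod int N))) 1"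
      using f(2) N_gt_1 by (intro aff_cong cong_mult) (simp_all add: cong_def)
    with nat_mult f(1) show "f \<in> generate G {transl N d}" by metis
  qed
qed

lemma normal_in_subgroupI:
  assumes A: "subgroup A G" and K: "subgroup K G" and "A \<subseteq> K"
    and conj: "\<And>x h. x \<in> K \<Longrightarrow> h \<in> A \<Longrightarrow> x \<otimes>\<^bsub>G\<^esub> h \<otimes>\<^bsub>G\<^esub> inv\<^bsub>G\<^esub> x \<in> A"
  shows "A \<lhd> G\<lparr>carrier := K\<rparr>"
proof -
  interpret K: group "G\<lparr>carrier := K\<rparr>"
    using K by (rule subgroup_imp_group)
  show ?thesis
    unfolding K.normal_inv_iff
    using subgroup_incl[OF A K \<open>A \<subseteq> K\<close>] conj m_inv_consistent[OF K] by simp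
qed

end

section \<open>The group of the dihedral action consists of the affine maps\<close>

text \<open>The orbits of \<open>\<rho>\<close> are the two parity classes, and equivariance under \<open>\<rho>\<close> makes \<open>f\<close> affine on
  each with the same slope. Equivariance under \<open>\<sigma>\<close> ties the values at \<open>0\<close> and \<open>1\<close> together. The
  slope on a class is only determined modulo \<open>n\<close>, since it acts on even steps; this freedom is used
  to choose \<open>u = f 1 - f 0\<close>.\<close>

lemma Aut_hat_imp_affine:
  assumes n: "n \<ge> 2" and f: "f \<in> Aut_hat n"
  obtains c u where "f = aff (2 * n) c u" "coprime u (int (2 * n))"
proof -
  define m where "m = int (2 * n)"
  have m: "m \<ge> 4" using n by (simp add: m_def)
  interpret residue_affine "2 * n" by unfold_locales (use n in simp)
  obtain \<phi> where fB: "f \<in> Bij (ZN (2 * n))" and \<phi>: "\<phi> \<in> auto (dihedral n)"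
    and equiv: "\<And>g x. g \<in> carrier (dihedral n) \<Longrightarrow> x \<in> ZN (2 * n) \<Longrightarrow>
       f (dihedral_act n g x) = dihedral_act n (\<phi> g) (f x)"
    using f by (auto simp: Aut_hat_def)
  have inj: "x = y" if "f x = f y" "0 \<le> x" "x < m" "0 \<le> y" "y < m" for x y
    using fB that by (auto simp: Bij_def bij_betw_def ZN_iff m_def dest: inj_onD)
  have range: "0 \<le> f x \<and> f x < m" if "0 \<le> x" "x < m" for x
    using Bij_imp_funcset[OF fB] that by (auto simp: ZN_iff m_def Pi_def)
  have surj: "\<exists>x. 0 \<le> x \<and> x < m \<and> f x = y" if "0 \<le> y" "y < m" for y
  proof -
    have "y \<in> f ` ZN (2 * n)" using fB that by (simp add: Bij_def bij_betw_def ZN_iff m_def)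
    then show ?thesis by (auto simp: ZN_iff m_def)
  qed
  have act: "dihedral_act n (i, a) x = ((if a then - x else x) + 2 * i) mod m"
    if "0 \<le> x" "x < m" for i a x
    using that by (simp add: dihedral_act_def ZN_iff m_def)
  have \<phi>_carrier: "\<phi> g \<in> carrier (dihedral n)" if "g \<in> carrier (dihedral n)" for g
    using \<phi> that by (auto simp: auto_def hom_def)
  have gens: "(1, False) \<in> carrier (dihedral n)" "(0, True) \<in> carrier (dihedral n)"
    using n by (auto simp: dihedral_simps)
  obtain j b where j: "\<phi> (1, False) = (j, b)" by (cases "\<phi> (1, False)")
  obtain i a where i: "\<phi> (0, True) = (i, a)" by (cases "\<phi> (0, True)")
  have jr: "0 \<le> j" "2 * j < m" and ir: "0 \<le> i" "2 * i < m"
    using \<phi>_carrier[OF gens(1)] \<phi>_carrier[OF gens(2)] j i by (auto simp: dihedral_simps m_def)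
  \<comment> \<open>A reflection \<open>\<rho>\<^sup>j \<sigma>\<close> fixes the point \<open>j\<close>, whereas \<open>\<rho>\<close> has no fixed point.\<close>
  have "\<not> b"
  proof
    assume b
    obtain x where x: "0 \<le> x" "x < m" "f x = j" using surj[of j] jr by auto
    have "f ((x + 2) mod m) = f x"
      using equiv[OF gens(1), of x] x jr \<open>b\<close> by (simp add: ZN_iff j act m_def[symmetric, simplified])
    from inj[OF this] have "(x + 2) mod m = x" using x m by simp
    then have "m dvd (x + 2) - x" by (metis mod_eq_dvd_iff mod_mod_trivial)
    then show False using m zdvd_imp_le[of m 2] by simp
  qed
  have step: "f ((x + 2) mod m) = (f x + 2 * j) mod m" if "0 \<le> x" "x < m" for x
    using equiv[OF gens(1), of x] that \<open>\<not> b\<close> range[OF that]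
    by (simp add: ZN_iff j act m_def[symmetric, simplified])
  have flip': "f ((- x) mod m) = ((if a then - f x else f x) + 2 * i) mod m"
    if "0 \<le> x" "x < m" for x
    using equiv[OF gens(2), of x] that range[OF that]
    by (simp add: ZN_iff i act m_def[symmetric, simplified])
  define c where "c = f 0"
  have c: "0 \<le> c" "c < m" using range[of 0] m by (auto simp: c_def)
  \<comment> \<open>Since \<open>\<sigma>\<close> fixes \<open>0\<close>, its image fixes \<open>f 0\<close>; a rotation doing so would be trivial.\<close>
  have a
  proof (rule ccontr)
    assume "\<not> a"
    then have "c = (c + 2 * i) mod m" using flip'[of 0] m by (simp add: c_def)
    then have "m dvd 2 * i"
      using c by (metis add.commute add_diff_cancel_left' mod_eq_dvd_iff mod_pos_pos_trivial)
    then have "i = 0" using ir zdvd_imp_le[of m "2 * i"] by linarith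
    then have "f ((- 1) mod m) = f 1" using flip'[of 1] range[of 1] m \<open>\<not> a\<close> by simp
    from inj[OF this] have "(- 1) mod m = 1" using m by simp
    then show False using m by (simp add: zmod_minus1)
  qed
  define u where "u = f 1 - c"
  have twice_c: "m dvd 2 * c - 2 * i"
  proof -
    have "c = (- c + 2 * i) mod m" using flip'[of 0] m \<open>a\<close> by (simp add: c_def)
    then have "m dvd c - (- c + 2 * i)"
      using c by (metis mod_eq_dvd_iff mod_pos_pos_trivial)
    then show ?thesis by simp
  qed
  have twice_u: "m dvd 2 * u - 2 * j"
  proof -
    have "f (m - 1) = (- f 1 + 2 * i) mod m"
      using flip'[of 1] m \<open>a\<close> by (simp add: zmod_minus1)
    moreover have "f 1 = (f (m - 1) + 2 * j) mod m"
      using step[of "m - 1"] m by simp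
    ultimately have "m dvd f (m - 1) - (- f 1 + 2 * i)" "m dvd f 1 - (f (m - 1) + 2 * j)"
      by (metis mod_eq_dvd_iff mod_mod_trivial)+
    from dvd_diff[OF dvd_add[OF this] twice_c] show ?thesis
      by (simp add: u_def algebra_simps)
  qed
  have orbit: "f ((x + 2 * int k) mod m) = (f x + u * (2 * int k)) mod m"
    if x: "0 \<le> x" "x < m" for x k
  proof (induction k)
    case 0
    then show ?case using x range[OF x] by simp
  next
    case (Suc k)
    have "f ((x + 2 * int (Suc k)) mod m) = f (((x + 2 * int k) mod m + 2) mod m)"
      by (simp add: mod_simps algebra_simps)
    also have "\<dots> = (f ((x + 2 * int k) mod m) + 2 * j) mod m"
      using m by (intro step) auto
    also have "\<dots> = (f x + u * (2 * int k) + 2 * j) mod m"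
      by (simp add: Suc mod_simps)
    also have "\<dots> = (f x + u * (2 * int (Suc k))) mod m"
    proof -
      have "m dvd (f x + u * (2 * int (Suc k))) - (f x + u * (2 * int k) + 2 * j)"
        using twice_u by (simp add: algebra_simps)
      then show ?thesis by (metis mod_eq_dvd_iff)
    qed
    finally show ?case .
  qed
  have affine: "f x = (u * x + c) mod m" if x: "0 \<le> x" "x < m" for x
  proof -
    define k where "k = nat (x div 2)"
    have "int k = x div 2" using x by (simp add: k_def)
    then have cases: "x = 0 + 2 * int k \<or> x = 1 + 2 * int k" by linarith
    have "f x = (f 0 + u * (2 * int k)) mod m" if "x = 0 + 2 * int k"
      using orbit[of 0 k] m x that by simp
    moreover have "f x = (f 1 + u * (2 * int k)) mod m" if "x = 1 + 2 * int k"
      using orbit[of 1 k] m x that by simp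
    moreover have "f 1 = u + c" by (simp add: u_def)
    ultimately show ?thesis using cases
      by (auto simp: algebra_simps c_def)
  qed
  have "f = aff (2 * n) c u"
  proof (rule extensionalityI[where A = "ZN (2 * n)"])
    show "f \<in> extensional (ZN (2 * n))" using fB by (rule Bij_imp_extensional)
    show "aff (2 * n) c u \<in> extensional (ZN (2 * n))" by (simp add: aff_def)
    show "f x = aff (2 * n) c u x" if "x \<in> ZN (2 * n)" for x
      using that affine[of x] by (simp add: aff_apply ZN_iff flip: m_def) (simp add: m_def aff_apply)
  qed
  moreover from this have "coprime u (int (2 * n))"
    using fB coprime_if_aff_Bij by auto
  ultimately show thesis by (rule that)
qed

lemma affine_in_Aut_hat:
  assumes n: "n > 0" and u: "coprime u (int (2 * n))"
  shows "aff (2 * n) c u \<in> Aut_hat n"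
proof -
  interpret residue_affine "2 * n" by unfold_locales (use n in simp)
  interpret D: group "dihedral n" using n by (rule group_dihedral)
  \<comment> \<open>Conjugation by \<open>x \<mapsto> u x + c\<close> sends \<open>\<rho>\<close> to \<open>\<rho>\<^sup>u\<close> and \<open>\<sigma>\<close> to \<open>\<rho>\<^sup>c \<sigma>\<close>.\<close>
  define \<phi> where "\<phi> = (\<lambda>(i, a) \<in> carrier (dihedral n).
    ((u * i + (if a then c else 0)) mod int n, a))"
  have \<phi>: "\<phi> (i, a) = ((u * i + (if a then c else 0)) mod int n, a)"
    if "0 \<le> i" "i < int n" for i a
    using that by (simp add: \<phi>_def dihedral_simps)
  have closed: "\<phi> \<in> carrier (dihedral n) \<rightarrow> carrier (dihedral n)"
    using n by (auto simp: \<phi> dihedral_simps)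
  have "\<phi> \<in> hom (dihedral n) (dihedral n)"
  proof (rule homI)
    fix x y assume "x \<in> carrier (dihedral n)" "y \<in> carrier (dihedral n)"
    then obtain i a j b where xy: "x = (i, a)" "y = (j, b)"
      "0 \<le> i" "i < int n" "0 \<le> j" "j < int n"
      by (cases x, cases y) (auto simp: dihedral_simps)
    have "(u * (t mod int n)) mod int n = (u * t) mod int n" for t
      by (rule mod_mult_right_eq)
    then show "\<phi> (x \<otimes>\<^bsub>dihedral n\<^esub> y) = \<phi> x \<otimes>\<^bsub>dihedral n\<^esub> \<phi> y"
      using xy n by (cases a; cases b)
        (simp_all add: dihedral_simps \<phi> affine_mod_arg, simp_all add: mod_simps, simp_all add: algebra_simps)
  qed (use closed in auto)
  moreover have "\<phi> \<in> Bij (carrier (dihedral n))"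
  proof -
    have "inj_on \<phi> (carrier (dihedral n))"
    proof (rule inj_onI)
      fix x y assume "x \<in> carrier (dihedral n)" "y \<in> carrier (dihedral n)" "\<phi> x = \<phi> y"
      then obtain i a j where xy: "x = (i, a)" "y = (j, a)"
        "0 \<le> i" "i < int n" "0 \<le> j" "j < int n"
        and eq: "[u * i + (if a then c else 0) = u * j + (if a then c else 0)] (mod int n)"
        by (cases x, cases y) (auto simp: dihedral_simps \<phi> cong_def)
      have "coprime u (int n)" using u by simp
      then have "[i = j] (mod int n)"
        using eq by (simp add: cong_add_rcancel cong_mult_lcancel)
      with xy show "x = y" by (simp add: cong_def)
    qed
    moreover have fin: "finite (carrier (dihedral n))" by (simp add: dihedral_simps)
    ultimately have "bij_betw \<phi> (carrier (dihedral n)) (carrier (dihedral n))"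
      using closed endo_inj_surj[OF fin, of \<phi>] by (auto simp: bij_betw_def)
    then show ?thesis by (simp add: Bij_def \<phi>_def)
  qed
  ultimately have "\<phi> \<in> auto (dihedral n)" by (simp add: auto_def)
  moreover have "aff (2 * n) c u (dihedral_act n g x) = dihedral_act n (\<phi> g) (aff (2 * n) c u x)"
    if g_in: "g \<in> carrier (dihedral n)" and x_in: "x \<in> ZN (2 * n)" for g x
  proof -
    define m where "m = 2 * int n"
    have m: "m > 0" using n by (simp add: m_def)
    obtain i a where g: "g = (i, a)" "0 \<le> i" "i < int n"
      using g_in by (cases g) (simp add: dihedral_simps)
    have x: "0 \<le> x" "x < m" using x_in by (simp_all add: ZN_iff m_def)
    have act: "dihedral_act n (k, e) y = ((if e then - y else y) + 2 * k) mod m"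
      if "0 \<le> y" "y < m" for k e y
      using that by (simp add: dihedral_act_def ZN_iff m_def)
    have aff: "aff (2 * n) c u y = (u * y + c) mod m" if "0 \<le> y" "y < m" for y
      using that by (simp add: aff_apply m_def)
    have red: "(s + 2 * (t mod int n)) mod m = (s + 2 * t) mod m" for s t
      unfolding m_def mult_mod_right by (rule mod_add_right_eq)
    have neg: "(- (t mod m) + s) mod m = (- t + s) mod m" for s t
      by (metis mod_add_left_eq mod_minus_eq)
    have left: "(t mod m + s) mod m = (t + s) mod m" for s t
      by (rule mod_add_left_eq)
    have scaled: "(u * (t mod m) + s) mod m = (u * t + s) mod m" for s t
      by (rule affine_mod_arg)
    have pos: "0 \<le> t mod m" "t mod m < m" for t using m by simp_all
    show ?thesis
      by (cases a)
        (simp_all only: g x \<phi> act aff pos red neg left scaled if_True if_False,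
          simp_all add: algebra_simps)
  qed
  ultimately show ?thesis
    using aff_Bij[OF u, of c] unfolding Aut_hat_def by blast
qed


section \<open>Stabilizers of symmetric sets containing all even residues\<close>

locale even_symmetric_set = residue_affine +
  fixes A :: "int set" and M :: int
  assumes A_subset: "A \<subseteq> ZN N"
    and N_eq: "int N = 2 * M" and even_M: "even M"
    and evens: "even x \<Longrightarrow> x mod int N \<in> A"
    and symmetric: "x mod int N \<in> A \<Longrightarrow> (- x) mod int N \<in> A"
begin

text \<open>The parameters \<open>c\<close>, \<open>u\<close> and the points \<open>x\<close> range over all integers, so that the arguments are
  integer arithmetic and no representatives have to be chosen.\<close>

definition stab :: "int \<Rightarrow> int \<Rightarrow> bool" where
  "stab c u \<longleftrightarrow> coprime u (int N) \<and>
     (\<forall>x. (u * x + c) mod int N \<in> A \<longleftrightarrow> x mod int N \<in> A)"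

lemma stabD: "stab c u \<Longrightarrow> (u * x + c) mod int N \<in> A \<longleftrightarrow> x mod int N \<in> A"
  by (simp add: stab_def)

lemma stab_coprime: "stab c u \<Longrightarrow> coprime u (int N)"
  by (simp add: stab_def)

lemma aff_image_iff_stab:
  assumes u: "coprime u (int N)"
  shows "aff N c u ` A = A \<longleftrightarrow> stab c u"
proof -
  have bij: "bij_betw (aff N c u) (ZN N) (ZN N)"
    using aff_Bij[OF u] by (simp add: Bij_def)
  have aff: "aff N c u (x mod int N) = (u * x + c) mod int N" for x
    using N_gt_1 by (simp add: aff_apply affine_mod_arg)
  show ?thesis
  proof
    assume img: "aff N c u ` A = A"
    have "(u * x + c) mod int N \<in> A \<longleftrightarrow> x mod int N \<in> A" for x
    proof -
      have "x mod int N \<in> ZN N" using N_gt_1 by (simp add: ZN_iff)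
      then have "aff N c u (x mod int N) \<in> aff N c u ` A \<longleftrightarrow> x mod int N \<in> A"
        using bij A_subset by (intro inj_on_image_mem_iff) (auto simp: bij_betw_def)
      then show ?thesis by (simp add: img aff)
    qed
    with u show "stab c u" by (simp add: stab_def)
  next
    assume stab: "stab c u"
    have iff: "aff N c u x \<in> A \<longleftrightarrow> x \<in> A" if "x \<in> ZN N" for x
      using stabD[OF stab, of x] that by (simp add: ZN_iff aff_apply)
    show "aff N c u ` A = A"
    proof
      show "aff N c u ` A \<subseteq> A" using iff A_subset by auto
      show "A \<subseteq> aff N c u ` A"
      proof
        fix y assume "y \<in> A"
        then obtain x where "x \<in> ZN N" "y = aff N c u x"
          using bij A_subset by (auto simp: bij_betw_def)
        with iff \<open>y \<in> A\<close> show "y \<in> aff N c u ` A" by auto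
      qed
    qed
  qed
qed

lemma stab_cong:
  assumes "[c = c'] (mod int N)" "[u = u'] (mod int N)" "stab c u"
  shows "stab c' u'"
proof -
  have "(u' * x + c') mod int N = (u * x + c) mod int N" for x
    using assms(1,2) cong_add[OF cong_mult[OF assms(2) cong_refl] assms(1), of x]
    by (simp add: cong_def)
  with assms(3) cong_imp_coprime[OF assms(2)] show ?thesis
    by (auto simp: stab_def)
qed

lemma stab_one: "stab 0 1"
  by (simp add: stab_def)

lemma stab_modulus: "stab (int N) 1"
  by (rule stab_cong[OF _ _ stab_one]) (simp_all add: cong_def)

lemma stab_mult:
  assumes "stab c u" "stab d v"
  shows "stab (u * d + c) (u * v)"
proof -
  have "(u * v * x + (u * d + c)) mod int N \<in> A \<longleftrightarrow> x mod int N \<in> A" for x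
    using stabD[OF assms(1), of "v * x + d"] stabD[OF assms(2), of x]
    by (simp add: algebra_simps)
  with assms show ?thesis by (simp add: stab_def)
qed

lemma stab_inverse:
  assumes "stab c u" "[u * v = 1] (mod int N)"
  shows "stab (- v * c) v"
proof -
  have "(v * x + - v * c) mod int N \<in> A \<longleftrightarrow> x mod int N \<in> A" for x
  proof -
    have "[u * v * (x - c) + c = 1 * (x - c) + c] (mod int N)"
      using assms(2) by (intro cong_add cong_mult) auto
    then have "(u * (v * x + - v * c) + c) mod int N = x mod int N"
      by (simp add: cong_def algebra_simps)
    with stabD[OF assms(1), of "v * x + - v * c"] show ?thesis by simp
  qed
  with inverse_coprime[OF assms(2)] show ?thesis by (simp add: stab_def)
qed

lemma symmetric_iff: "(- x) mod int N \<in> A \<longleftrightarrow> x mod int N \<in> A"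
  using symmetric[of x] symmetric[of "- x"] by auto

text \<open>This is \<open>T\<^bsub>2c\<^esub> = g (f\<^bsub>-1\<^esub> g f\<^bsub>-1\<^esub>)\<^sup>-\<^sup>1\<close> for \<open>g = T\<^sub>c f\<^sub>u\<close>, carried out on points: this is
  where the symmetry of \<open>A\<close> enters.\<close>

lemma stab_double:
  assumes "stab c u"
  shows "stab (2 * c) 1"
proof -
  obtain v where v: "[u * v = 1] (mod int N)" using ex_inverse[OF stab_coprime[OF assms]] .
  have "(x + 2 * c) mod int N \<in> A \<longleftrightarrow> x mod int N \<in> A" for x
  proof -
    have *: "(u * (v * y) + c) mod int N = (y + c) mod int N" for y
      using cong_add[OF cong_mult[OF v cong_refl] cong_refl, of y c]
      by (simp add: cong_def mult.assoc)
    have "(x + 2 * c) mod int N = (u * (v * (x + c)) + c) mod int N"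
      using *[of "x + c"] by (simp add: algebra_simps)
    then have "(x + 2 * c) mod int N \<in> A \<longleftrightarrow> (v * (x + c)) mod int N \<in> A"
      using stabD[OF assms, of "v * (x + c)"] by simp
    also have "\<dots> \<longleftrightarrow> (v * (- (x + c))) mod int N \<in> A"
      using symmetric_iff[of "v * (x + c)"] by (simp only: mult_minus_right)
    also have "\<dots> \<longleftrightarrow> (u * (v * (- (x + c))) + c) mod int N \<in> A"
      using stabD[OF assms] by simp
    also have "\<dots> \<longleftrightarrow> (- x) mod int N \<in> A"
      using *[of "- (x + c)"] by simp
    finally show ?thesis using symmetric_iff by simp
  qed
  then show ?thesis by (simp add: stab_def add.commute)
qed

lemma even_times_M: "even x \<Longrightarrow> [x * M = 0] (mod int N)"
  by (auto simp: N_eq cong_0_iff)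

lemma unit_odd: "coprime u (int N) \<Longrightarrow> odd u"
  using N_eq even_M by (auto simp: coprime_mult_right_iff)

lemma involution_square: "[(1 + M) * (1 + M) = 1] (mod int N)"
proof -
  have "[1 + (2 * M + M * M) = 1 + 0] (mod int N)"
    using cong_add[OF even_times_M[of 2] even_times_M[OF even_M]]
    by (intro cong_add) auto
  then show ?thesis by (simp add: algebra_simps)
qed

text \<open>The map \<open>x \<mapsto> (1 + M) x + M\<close> fixes every odd residue, and it preserves parity, so
  it permutes the even residues, all of which lie in \<open>A\<close>.\<close>

lemma stab_involution: "stab M (1 + M)"
proof -
  have "((1 + M) * x + M) mod int N \<in> A \<longleftrightarrow> x mod int N \<in> A" for x
  proof (cases "even x")
    case True
    then have "even ((1 + M) * x + M)" using even_M by simp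
    with True evens show ?thesis by blast
  next
    case False
    then have "[x + (x + 1) * M = x + 0] (mod int N)"
      by (intro cong_add even_times_M) simp_all
    then have "((1 + M) * x + M) mod int N = x mod int N"
      by (simp add: cong_def algebra_simps)
    then show ?thesis by simp
  qed
  with inverse_coprime[OF involution_square] show ?thesis by (simp add: stab_def)
qed

end

locale half_turn_free_set = even_symmetric_set +
  assumes half_translation: "\<not> stab M 1"
    and half_scaling: "\<not> stab 0 (1 + M)"
begin

text \<open>Units modulo \<open>N\<close> are odd, so an odd \<open>c\<close> would map the odd residues onto the even ones and
  \<open>A\<close> would contain every residue; but then \<open>T\<^sub>M\<close> would stabilize it.\<close>

lemma stab_imp_even:
  assumes "stab c u"
  shows "even c"
proof (rule ccontr)
  assume "odd c"
  have all: "x mod int N \<in> A" for x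
  proof (cases "even x")
    case False
    then have "even (u * x + c)"
      using \<open>odd c\<close> unit_odd[OF stab_coprime[OF assms]] by simp
    then show ?thesis using evens stabD[OF assms] by blast
  qed (rule evens)
  with half_translation show False by (simp add: stab_def)
qed

text \<open>The stabilizing translations form a subgroup of the integers, generated by its least
  positive element \<open>t\<close>.\<close>

lemma translation_period:
  obtains t where "even t" "\<And>c. stab c 1 \<longleftrightarrow> t dvd c"
proof -
  define t where "t = int (LEAST k. 0 < k \<and> stab (int k) 1)"
  have add: "stab (c + d) 1" if "stab c 1" "stab d 1" for c d
    using stab_mult[OF that] by (simp add: add.commute)
  have uminus: "stab (- c) 1" if "stab c 1" for c
    using stab_inverse[OF that, of 1] by simp
  have "0 < N \<and> stab (int N) 1" using N_gt_1 stab_modulus by simp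
  then have t: "0 < t" "stab t 1"
    unfolding t_def by (metis (mono_tags, lifting) LeastI of_nat_0_less_iff)+
  have least: "t \<le> c" if "stab c 1" "c > 0" for c
    unfolding t_def using that Least_le[of "\<lambda>k. 0 < k \<and> stab (int k) 1" "nat c"] by simp
  have nat_multiple: "stab (t * int k) 1" for k
  proof (induction k)
    case (Suc k)
    from add[OF Suc t(2)] show ?case by (simp add: algebra_simps)
  qed (simp add: stab_one)
  have multiple: "stab (t * k) 1" for k
  proof (cases "k \<ge> 0")
    case True
    then show ?thesis using nat_multiple[of "nat k"] by simp
  next
    case False
    then show ?thesis using uminus[OF nat_multiple[of "nat (- k)"]] by simp
  qed
  have "t dvd c" if "stab c 1" for c
  proof -
    have "c mod t = c + t * (- (c div t))" by (simp add: minus_mult_div_eq_mod[symmetric])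
    then have "stab (c mod t) 1" using add[OF that multiple] by metis
    then have "\<not> c mod t > 0"
      using least[of "c mod t"] pos_mod_bound[OF t(1), of c] by linarith
    then have "c mod t = 0" using pos_mod_sign[OF t(1), of c] by linarith
    then show ?thesis by (simp add: dvd_eq_mod_eq_0)
  qed
  then have "stab c 1 \<longleftrightarrow> t dvd c" for c using multiple by (auto elim: dvdE)
  then show thesis using that t(2) stab_imp_even by blast
qed

text \<open>The second alternative is the first one for the product with \<open>\<tau>\<close>, whose parameters are
  \<open>(M + c, (1 + M) u)\<close> because \<open>c\<close> is even.\<close>

lemma stab_split:
  assumes t: "even t" "\<And>c. stab c 1 \<longleftrightarrow> t dvd c"
    and "stab c u"
  shows "t dvd c \<and> stab 0 u \<or> t dvd M + c \<and> stab 0 ((1 + M) * u)"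
proof -
  have remove: "stab 0 w" if "t dvd d" "stab d w" for d w
  proof -
    have "stab (- d) 1" using t(2) that(1) by simp
    from stab_mult[OF this that(2)] show ?thesis by simp
  qed
  show ?thesis
  proof (cases "t dvd c")
    case True
    then show ?thesis using remove \<open>stab c u\<close> by auto
  next
    case False
    obtain m where m: "t = 2 * m" using t(1) by (elim evenE)
    have "\<not> t dvd M" using half_translation t(2) by simp
    have "t dvd int N" using stab_modulus by (simp add: t(2))
    then obtain a where a: "M = m * a" by (auto simp: m N_eq)
    obtain b where b: "c = m * b"
      using stab_double[OF \<open>stab c u\<close>] by (auto simp: t(2) m)
    \<comment> \<open>Both \<open>M\<close> and \<open>c\<close> are odd multiples of \<open>t / 2\<close>, so \<open>t\<close> divides their sum.\<close>
    have "odd a" "odd b"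
      using \<open>\<not> t dvd M\<close> \<open>\<not> t dvd c\<close> by (auto simp: a b m)
    then have "t dvd m * (a + b)" by (auto simp: m)
    then have dvd: "t dvd M + c" by (simp add: a b algebra_simps)
    have "[c * M = 0] (mod int N)"
      using even_times_M stab_imp_even[OF \<open>stab c u\<close>] by simp
    then have "[(1 + M) * c + M = M + c] (mod int N)"
      using cong_add[of "c * M" 0 "int N" "M + c" "M + c"] by (simp add: algebra_simps)
    from stab_cong[OF this cong_refl stab_mult[OF stab_involution \<open>stab c u\<close>]]
    have "stab (M + c) ((1 + M) * u)" .
    with dvd remove show ?thesis by auto
  qed
qed

abbreviation stabilizer where
  "stabilizer \<equiv> {aff N c u | c u. stab c u}"

abbreviation \<tau> where "\<tau> \<equiv> aff N M (1 + M)"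

lemma stabilizer_subgroup: "subgroup stabilizer G"
  by (rule aff_subgroup) (use stab_coprime stab_one stab_mult stab_inverse in auto)

lemma generate_involution: "generate G {\<tau>} = {\<one>\<^bsub>G\<^esub>, \<tau>}"
proof
  have cop: "coprime (1 + M) (int N)" by (rule stab_coprime[OF stab_involution])
  have M2: "[(1 + M) * M + M = 0] (mod int N)"
    using even_times_M[of "2 + M"] even_M by (simp add: algebra_simps)
  have square: "\<tau> \<otimes>\<^bsub>G\<^esub> \<tau> = \<one>\<^bsub>G\<^esub>"
    unfolding aff_mult[OF cop cop] one_eq_aff by (rule aff_cong[OF M2 involution_square])
  have carrier: "\<tau> \<in> carrier G" by (rule aff_carrier[OF cop])
  have "inv\<^bsub>G\<^esub> \<tau> = \<tau>" using square carrier carrier by (rule inv_equality)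
  then have "subgroup {\<one>\<^bsub>G\<^esub>, \<tau>} G"
    using square carrier by (intro subgroupI) auto
  then show "generate G {\<tau>} \<subseteq> {\<one>\<^bsub>G\<^esub>, \<tau>}" by (intro generate_subgroup_incl) auto
qed (auto intro: generate.intros)

lemma stabilizer_decomposition:
  "\<exists>m H K. subgroup H (units_of (residue_ring (int N))) \<and> H \<subset> UZN N \<and>
    generate G {transl N (2 * m)} \<subset> generate G {transl N 2} \<and>
    internal_semidirect G K (generate G {transl N (2 * m)}) (scal N ` H) \<and>
    internal_direct G stabilizer (generate G {\<tau>}) K"
proof -
  obtain t where t: "even t" "\<And>c. stab c 1 \<longleftrightarrow> t dvd c"
    using translation_period by blast
  have t_not_dvd: "\<not> t dvd M" using half_translation t(2) by simp
  have t_dvd_N: "t dvd int N" using stab_modulus by (simp add: t(2))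
  have t_cong: "t dvd c \<longleftrightarrow> t dvd c'" if "[c = c'] (mod int N)" for c c'
    using that t_dvd_N by (meson cong_dvd_iff cong_dvd_modulus)
  define m where "m = t div 2"
  have m: "2 * m = t" using t(1) by (simp add: m_def)
  define H where "H = {u \<in> UZN N. stab 0 u}"
  interpret R: residues "int N" "residue_ring (int N)"
    by unfold_locales (use N_gt_1 in simp_all)
  define T where "T = generate G {transl N t}"
  have T: "T = {aff N c u | c u. [u = 1] (mod int N) \<and> t dvd c}"
    unfolding T_def by (rule generate_transl)
  have T_iff: "aff N c u \<in> T \<longleftrightarrow> [u = 1] (mod int N) \<and> t dvd c" for c u
  proof
    assume "aff N c u \<in> T"
    then obtain d v where "[c = d] (mod int N)" "[u = v] (mod int N)" "t dvd d" "[v = 1] (mod int N)"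
      by (auto simp: T aff_eq_iff)
    then show "[u = 1] (mod int N) \<and> t dvd c" using t_cong cong_trans by blast
  qed (auto simp: T)
  define K where "K = {aff N c u | c u. t dvd c \<and> stab 0 u}"
  have K_iff: "aff N c u \<in> K \<longleftrightarrow> t dvd c \<and> stab 0 u" for c u
  proof
    assume "aff N c u \<in> K"
    then obtain d v where "[c = d] (mod int N)" "[u = v] (mod int N)" "t dvd d" "stab 0 v"
      by (auto simp: K_def aff_eq_iff)
    then show "t dvd c \<and> stab 0 u"
      using t_cong stab_cong[OF cong_refl] cong_sym by blast
  qed (auto simp: K_def)
  have unit_mod: "u mod int N \<in> UZN N" if "coprime u (int N)" for u
  proof -
    have cop: "coprime (u mod int N) (int N)" using that N_gt_1 by simp
    then have "u mod int N \<noteq> 0" using N_gt_1 by auto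
    then have "0 < u mod int N \<and> u mod int N < int N"
      using N_gt_1 pos_mod_sign[of "int N" u] pos_mod_bound[of "int N" u] by linarith
    with cop show ?thesis by (simp add: R.res_units_eq)
  qed
  have scal_H: "scal N ` H = {aff N c u | c u. [c = 0] (mod int N) \<and> stab 0 u}"
  proof (intro subset_antisym subsetI)
    fix f assume "f \<in> {aff N c u | c u. [c = 0] (mod int N) \<and> stab 0 u}"
    then obtain c u where f: "f = aff N c u" "[c = 0] (mod int N)" "stab 0 u" by auto
    have "f = aff N 0 (u mod int N)" using f(1,2) by (auto simp: aff_eq_iff)
    moreover have "u mod int N \<in> H"
      using f(3) unit_mod[OF stab_coprime[OF f(3)]] stab_cong[OF cong_refl _ f(3), of "u mod int N"]
      by (simp add: H_def cong_def)
    ultimately show "f \<in> scal N ` H" by (auto simp: scal_eq_aff)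
  next
    fix f assume "f \<in> scal N ` H"
    then obtain u where "f = aff N 0 u" "stab 0 u" by (auto simp: H_def scal_eq_aff)
    then show "f \<in> {aff N c u | c u. [c = 0] (mod int N) \<and> stab 0 u}"
      using cong_refl by blast
  qed

  have H_subgroup: "subgroup H (units_of (residue_ring (int N)))"
  proof (rule group.subgroupI[OF R.units_group])
    show "H \<subseteq> carrier (units_of (residue_ring (int N)))" by (auto simp: H_def units_of_carrier)
    have "1 \<in> H" using stab_one N_gt_1 by (simp add: H_def R.res_units_eq)
    then show "H \<noteq> {}" by blast
  next
    fix u assume u: "u \<in> H"
    then have uU: "u \<in> UZN N" by (simp add: H_def)
    let ?v = "inv\<^bsub>residue_ring (int N)\<^esub> u"
    have "[u * ?v = 1] (mod int N)"
      using R.Units_r_inv[OF uU] N_gt_1 by (simp add: R.res_mult_eq R.res_one_eq cong_def)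
    from stab_inverse[OF _ this, of 0] u have "?v \<in> H"
      using R.Units_inv_Units[OF uU] by (simp add: H_def)
    then show "inv\<^bsub>units_of (residue_ring (int N))\<^esub> u \<in> H"
      using R.units_of_inv[OF uU] by simp
  next
    fix u v assume uv: "u \<in> H" "v \<in> H"
    then have "stab 0 (u * v)" using stab_mult[of 0 u 0 v] by (simp add: H_def)
    then have "stab 0 (u * v mod int N)" by (rule stab_cong[rotated 2]) (simp_all add: cong_def)
    with uv R.Units_m_closed[of u v]
    show "u \<otimes>\<^bsub>units_of (residue_ring (int N))\<^esub> v \<in> H"
      by (simp add: H_def units_of_mult R.res_mult_eq)
  qed
  have H_proper: "H \<subset> UZN N"
  proof -
    have "(1 + M) mod int N \<in> UZN N"
      by (rule unit_mod[OF stab_coprime[OF stab_involution]])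
    moreover have "(1 + M) mod int N \<notin> H"
      using stab_cong[OF cong_refl, of "(1 + M) mod int N" "1 + M" 0] half_scaling
      by (auto simp: H_def cong_def)
    ultimately show ?thesis by (auto simp: H_def)
  qed
  have T_proper: "T \<subset> generate G {transl N 2}"
  proof -
    have "aff N M 1 \<notin> T"
      using t_not_dvd by (simp add: T_iff)
    moreover have "aff N M 1 \<in> generate G {transl N 2}"
      unfolding generate_transl using even_M by (intro CollectI exI[of _ M] exI[of _ 1]) simp
    moreover have "T \<subseteq> generate G {transl N 2}"
      unfolding generate_transl T using t(1) dvd_trans by blast
    ultimately show ?thesis by blast
  qed

  have K_subgroup: "subgroup K G"
    unfolding K_def
  proof (rule aff_subgroup)
    fix c u d v assume "t dvd c \<and> stab 0 u" "t dvd d \<and> stab 0 v"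
    then show "t dvd u * d + c \<and> stab 0 (u * v)"
      using stab_mult[of 0 u 0 v] by simp
  next
    fix c u v assume "t dvd c \<and> stab 0 u" "[u * v = 1] (mod int N)"
    then show "t dvd - v * c \<and> stab 0 v" using stab_inverse[of 0 u v] by simp
  qed (use stab_coprime stab_one in auto)
  have T_subgroup: "subgroup T G" unfolding T by (rule translation_subgroup)
  have T_subset: "T \<subseteq> K"
    using stab_cong[OF cong_refl _ stab_one] by (auto simp: T K_iff cong_sym)
  have K_subset: "K \<subseteq> stabilizer"
  proof
    fix f assume "f \<in> K"
    then obtain c u where f: "f = aff N c u" "t dvd c" "stab 0 u" by (auto simp: K_def)
    then have "stab c 1" by (simp add: t(2))
    from stab_mult[OF this f(3)] f(1) show "f \<in> stabilizer" by auto
  qed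
  have semidirect: "internal_semidirect G K T (scal N ` H)"
    unfolding internal_semidirect_def
  proof (intro conjI)
    show "T \<lhd> G\<lparr>carrier := K\<rparr>"
    proof (rule normal_in_subgroupI[OF T_subgroup K_subgroup T_subset])
      fix x h assume "x \<in> K" "h \<in> T"
      then obtain c u d v where "x = aff N c u" "t dvd c" "coprime u (int N)"
        "h = aff N d v" "t dvd d" "[v = 1] (mod int N)"
        using stab_coprime by (auto simp: K_def T)
      moreover from this have "coprime v (int N)"
        by (metis coprime_1_left cong_imp_coprime cong_sym)
      ultimately show "x \<otimes>\<^bsub>G\<^esub> h \<otimes>\<^bsub>G\<^esub> inv\<^bsub>G\<^esub> x \<in> T"
        by (simp add: aff_conj T_iff)
    qed
    have "subgroup (scal N ` H) G"
      unfolding scal_H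
    proof (rule aff_subgroup)
      fix c u d v assume *: "[c = 0] (mod int N) \<and> stab 0 u" "[d = 0] (mod int N) \<and> stab 0 v"
      then show "[u * d + c = 0] (mod int N) \<and> stab 0 (u * v)"
        using stab_mult[of 0 u 0 v] by (simp add: cong_0_iff)
    next
      fix c u v assume "[c = 0] (mod int N) \<and> stab 0 u" "[u * v = 1] (mod int N)"
      then show "[- v * c = 0] (mod int N) \<and> stab 0 v"
        using stab_inverse[of 0 u v] by (simp add: cong_0_iff)
    qed (use stab_coprime stab_one in auto)
    moreover have "scal N ` H \<subseteq> K"
      by (auto simp: scal_eq_aff H_def K_iff)
    ultimately show "subgroup (scal N ` H) (G\<lparr>carrier := K\<rparr>)"
      using K_subgroup by (intro subgroup_incl)
    show "T \<inter> scal N ` H = {\<one>\<^bsub>G\<^esub>}"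
    proof
      show "T \<inter> scal N ` H \<subseteq> {\<one>\<^bsub>G\<^esub>}"
      proof
        fix f assume "f \<in> T \<inter> scal N ` H"
        then have "f \<in> T" "f \<in> scal N ` H" by simp_all
        then obtain c u d v where f: "f = aff N c u" "[u = 1] (mod int N)"
          "f = aff N d v" "[d = 0] (mod int N)"
          unfolding T scal_H by blast
        then have "[c = d] (mod int N)" using aff_eq_iff by metis
        from cong_trans[OF this f(4)] have "[c = 0] (mod int N)" .
        then show "f \<in> {\<one>\<^bsub>G\<^esub>}" unfolding f(1) one_eq_aff using f(2) aff_cong by simp
      qed
      show "{\<one>\<^bsub>G\<^esub>} \<subseteq> T \<inter> scal N ` H"
        using subgroup.one_closed[OF T_subgroup] subgroup.one_closed[OF \<open>subgroup (scal N ` H) G\<close>]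
        by simp
    qed
    show "K = T <#>\<^bsub>G\<^esub> scal N ` H"
    proof
      show "T <#>\<^bsub>G\<^esub> scal N ` H \<subseteq> K"
        using T_subset \<open>scal N ` H \<subseteq> K\<close> subgroup.m_closed[OF K_subgroup]
        by (auto simp: set_mult_def)
      show "K \<subseteq> T <#>\<^bsub>G\<^esub> scal N ` H"
      proof
        fix f assume "f \<in> K"
        then obtain c u where f: "f = aff N c u" "t dvd c" "stab 0 u" by (auto simp: K_def)
        have "aff N c 1 \<in> T" using f(2) by (simp add: T_iff)
        moreover have "aff N 0 u \<in> scal N ` H" using f(3) cong_refl unfolding scal_H by blast
        moreover have "f = aff N c 1 \<otimes>\<^bsub>G\<^esub> aff N 0 u"
          using f(1) stab_coprime[OF f(3)] by (simp add: aff_mult)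
        ultimately show "f \<in> T <#>\<^bsub>G\<^esub> scal N ` H" unfolding set_mult_def by blast
      qed
    qed
  qed (rule K_subgroup)

  have \<tau>_coprime: "coprime (1 + M) (int N)" by (rule stab_coprime[OF stab_involution])
  have \<tau>_stabilizer: "\<tau> \<in> stabilizer" using stab_involution by auto
  have \<tau>_central: "x \<otimes>\<^bsub>G\<^esub> \<tau> \<otimes>\<^bsub>G\<^esub> inv\<^bsub>G\<^esub> x = \<tau>"
    if x_in: "x \<in> stabilizer" for x
  proof -
    obtain c u where x: "x = aff N c u" "stab c u" using x_in by blast
    have "even (u - 1 - c)"
      using unit_odd[OF stab_coprime[OF x(2)]] stab_imp_even[OF x(2)] by simp
    from cong_add[OF even_times_M[OF this] cong_refl[of M]]
    have "[c + u * M - (1 + M) * c = M] (mod int N)" by (simp add: algebra_simps)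
    then show ?thesis
      unfolding x(1) aff_conj[OF stab_coprime[OF x(2)] \<tau>_coprime] by (rule aff_cong) simp
  qed
  have generate_subgroup: "subgroup {\<one>\<^bsub>G\<^esub>, \<tau>} G"
    using generate_is_subgroup[of "{\<tau>}"] aff_carrier[OF \<tau>_coprime]
    by (simp add: generate_involution)
  have direct: "internal_direct G stabilizer {\<one>\<^bsub>G\<^esub>, \<tau>} K"
    unfolding internal_direct_def
  proof (intro conjI)
    show "subgroup stabilizer G" by (rule stabilizer_subgroup)
    show "{\<one>\<^bsub>G\<^esub>, \<tau>} \<lhd> G\<lparr>carrier := stabilizer\<rparr>"
    proof (rule normal_in_subgroupI[OF generate_subgroup stabilizer_subgroup])
      show "{\<one>\<^bsub>G\<^esub>, \<tau>} \<subseteq> stabilizer"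
        using \<tau>_stabilizer subgroup.one_closed[OF stabilizer_subgroup] by blast
      fix x h assume "x \<in> stabilizer" "h \<in> {\<one>\<^bsub>G\<^esub>, \<tau>}"
      then show "x \<otimes>\<^bsub>G\<^esub> h \<otimes>\<^bsub>G\<^esub> inv\<^bsub>G\<^esub> x \<in> {\<one>\<^bsub>G\<^esub>, \<tau>}"
        using \<tau>_central[of x] subgroup.mem_carrier[OF stabilizer_subgroup, of x]
        by (elim insertE) (simp_all del: mem_Collect_eq)
    qed
    show "K \<lhd> G\<lparr>carrier := stabilizer\<rparr>"
    proof (rule normal_in_subgroupI[OF K_subgroup stabilizer_subgroup K_subset])
      fix x h assume "x \<in> stabilizer" "h \<in> K"
      then obtain c u d v where x: "x = aff N c u" "stab c u"
        and h: "h = aff N d v" "t dvd d" "stab 0 v"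
        by (auto simp: K_def)
      \<comment> \<open>The conjugate has translation part \<open>(1 - v) c + u d\<close>, and \<open>t\<close> need not divide \<open>c\<close>, but it
        divides \<open>2 c\<close>, and \<open>1 - v\<close> is even.\<close>
      have "even (1 - v)" using unit_odd[OF stab_coprime[OF h(3)]] by simp
      moreover have "t dvd 2 * c" using stab_double[OF x(2)] by (simp add: t(2))
      ultimately obtain w where "(1 - v) * c = w * (2 * c)" "t dvd 2 * c"
        by (metis evenE mult.assoc mult.commute)
      then have "t dvd (1 - v) * c" using dvd_mult by metis
      then have "t dvd (1 - v) * c + u * d" using h(2) by simp
      then have "t dvd c + u * d - v * c" by (simp add: algebra_simps)
      then show "x \<otimes>\<^bsub>G\<^esub> h \<otimes>\<^bsub>G\<^esub> inv\<^bsub>G\<^esub> x \<in> K"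
        using h x stab_coprime by (simp add: aff_conj K_iff)
    qed
    have "\<tau> \<notin> K" using half_scaling by (simp add: K_iff)
    then show "{\<one>\<^bsub>G\<^esub>, \<tau>} \<inter> K = {\<one>\<^bsub>G\<^esub>}"
      using subgroup.one_closed[OF K_subgroup] by auto
    show "stabilizer = {\<one>\<^bsub>G\<^esub>, \<tau>} <#>\<^bsub>G\<^esub> K"
    proof
      show "{\<one>\<^bsub>G\<^esub>, \<tau>} <#>\<^bsub>G\<^esub> K \<subseteq> stabilizer"
        using \<tau>_stabilizer K_subset subgroup.m_closed[OF stabilizer_subgroup]
          subgroup.one_closed[OF stabilizer_subgroup]
        unfolding set_mult_def by blast
      show "stabilizer \<subseteq> {\<one>\<^bsub>G\<^esub>, \<tau>} <#>\<^bsub>G\<^esub> K"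
      proof
        fix f assume "f \<in> stabilizer"
        then obtain c u where f: "f = aff N c u" "stab c u" by auto
        then have cop: "coprime u (int N)" by (simp add: stab_coprime)
        consider "t dvd c" "stab 0 u" | "t dvd M + c" "stab 0 ((1 + M) * u)"
          using stab_split[OF t(1,2) f(2)] by blast
        then show "f \<in> {\<one>\<^bsub>G\<^esub>, \<tau>} <#>\<^bsub>G\<^esub> K"
        proof cases
          case 1
          then have "f \<in> K" by (simp add: f(1) K_iff)
          moreover from this have "f = \<one>\<^bsub>G\<^esub> \<otimes>\<^bsub>G\<^esub> f"
            using subgroup.mem_carrier[OF K_subgroup] by simp
          ultimately show ?thesis unfolding set_mult_def by blast
        next
          case 2
          \<comment> \<open>Multiplying by the involution a second time recovers \<open>f\<close>.\<close>
          have "even (2 + c + M)" using stab_imp_even[OF f(2)] even_M by simp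
          from cong_add[OF even_times_M[OF this] cong_refl[of c]]
          have "[(1 + M) * (M + c) + M = c] (mod int N)" by (simp add: algebra_simps)
          moreover have "[(1 + M) * ((1 + M) * u) = u] (mod int N)"
            using cong_mult[OF involution_square cong_refl[of u]] by (simp add: mult.assoc)
          ultimately have "aff N ((1 + M) * (M + c) + M) ((1 + M) * ((1 + M) * u)) = f"
            unfolding f(1) by (rule aff_cong)
          then have "f = \<tau> \<otimes>\<^bsub>G\<^esub> aff N (M + c) ((1 + M) * u)"
            using stab_coprime[OF 2(2)] \<tau>_coprime by (simp only: aff_mult)
          moreover have "aff N (M + c) ((1 + M) * u) \<in> K" using 2 by (simp add: K_iff)
          ultimately show ?thesis unfolding set_mult_def by blast
        qed
      qed
    qed
  qed
  show ?thesis
    using H_subgroup H_proper T_proper semidirect direct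
    unfolding T_def generate_involution m[symmetric] by blast
qed

end

section \<open>The dihedral sieve\<close>

text \<open>The multiples of \<open>p\<close> are closed under negation, and the sign \<open>s\<close> takes care of the rest.\<close>

lemma sieve_set_symmetric:
  assumes "x mod int N \<in> sieve_set N"
  shows "(- x) mod int N \<in> sieve_set N"
proof -
  have neg: "(- x) mod int N = (- y) mod int N" if "x mod int N = y mod int N" for y
    using that by (metis mod_minus_eq)
  show ?thesis
    using assms unfolding sieve_set_def
  proof (elim UnE UN_E, goal_cases)
    case (1 p)
    then obtain k where "x mod int N = (k * int p) mod int N" by auto
    from neg[OF this] have "(- x) mod int N = (- k * int p) mod int N" by simp
    with 1 show ?case by blast
  next
    case (2 q)
    then obtain s j where sj: "x mod int N = (s * int j * int q) mod int N"
      "s \<in> {1, - 1}" "2 \<le> j" "int j \<le> \<lfloor>real N / real q\<rfloor>" by auto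
    have "(- x) mod int N = (- s * int j * int q) mod int N" "- s \<in> {1, - 1}"
      using neg[OF sj(1)] sj(2) by auto
    with 2 sj(3,4) show ?case by blast
  qed
qed

lemma even_in_sieve_set:
  assumes "even x"
  shows "x mod int N \<in> sieve_set N"
proof -
  obtain k where "x = k * int 2" using assms by (auto elim!: evenE)
  then show ?thesis unfolding sieve_set_def by blast
qed

lemma sieve_set_subset: "N > 0 \<Longrightarrow> sieve_set N \<subseteq> ZN N"
  by (auto simp: sieve_set_def ZN_iff)

theorem proposition7p4:
  fixes N k Nbar :: nat
  assumes "N = 2 ^ k * Nbar" and "k > 1" and "odd Nbar"
    and "transl N (int (2 ^ (k - 1) * Nbar)) \<notin> sieve_group N"
    and "scal N (1 + int (2 ^ (k - 1) * Nbar)) \<notin> sieve_group N"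
  shows "\<exists>(m::int) (H::int set) K.
    subgroup H (units_of (residue_ring (int N))) \<and> H \<subset> UZN N \<and>
    generate (BijGroup (ZN N)) {transl N (2 * m)} \<subset> generate (BijGroup (ZN N)) {transl N 2} \<and>
    internal_semidirect (BijGroup (ZN N)) K
      (generate (BijGroup (ZN N)) {transl N (2 * m)}) (scal N ` H) \<and>
    internal_direct (BijGroup (ZN N)) (sieve_group N)
      (generate (BijGroup (ZN N))
        {transl N (int (2 ^ (k - 1) * Nbar))
           \<otimes>\<^bsub>BijGroup (ZN N)\<^esub> scal N (1 + int (2 ^ (k - 1) * Nbar))})
      K"
proof -
  define M where "M = int (2 ^ (k - 1) * Nbar)"
  obtain l where l: "k = Suc (Suc l)" using \<open>k > 1\<close> by (metis less_imp_Suc_add plus_1_eq_Suc add_Suc)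
  have M: "int N = 2 * M" "even M" by (simp_all add: M_def assms(1) l)
  have "Nbar > 0" using \<open>odd Nbar\<close> by (rule odd_pos)
  then have N_ge: "N \<ge> 4" by (simp add: assms(1) l)
  interpret even_symmetric_set N "sieve_set N" M
  proof unfold_locales
    show "sieve_set N \<subseteq> ZN N" using N_ge by (intro sieve_set_subset) simp
  qed (use N_ge in \<open>simp_all add: even_in_sieve_set sieve_set_symmetric, simp_all add: M\<close>)
  have half: "2 * (N div 2) = N" "N div 2 \<ge> 2" using N_ge M(1) by presburger+
  have member: "aff N c u \<in> sieve_group N \<longleftrightarrow> stab c u" if "coprime u (int N)" for c u
    using affine_in_Aut_hat[of "N div 2" u c] aff_image_iff_stab[OF that, of c] half that
    by (simp add: sieve_group_def)
  have sieve_group: "sieve_group N = {aff N c u | c u. stab c u}"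
  proof
    show "sieve_group N \<subseteq> {aff N c u | c u. stab c u}"
    proof
      fix f assume f: "f \<in> sieve_group N"
      then have "f \<in> Aut_hat (N div 2)" by (simp add: sieve_group_def)
      then obtain c u where "f = aff N c u" "coprime u (int N)"
        using Aut_hat_imp_affine[OF half(2)] unfolding half(1) by metis
      with member f show "f \<in> {aff N c u | c u. stab c u}" by auto
    qed
    show "{aff N c u | c u. stab c u} \<subseteq> sieve_group N"
      using member stab_coprime by auto
  qed
  have coprime: "coprime (1 + M) (int N)" by (rule stab_coprime[OF stab_involution])
  have "\<not> stab M 1" "\<not> stab 0 (1 + M)"
    using assms(4,5) member[OF coprime] member[of 1]
    unfolding transl_eq_aff scal_eq_aff M_def[symmetric] by simp_all
  then interpret half_turn_free_set N "sieve_set N" M by unfold_locales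
  have "transl N M \<otimes>\<^bsub>G\<^esub> scal N (1 + M) = \<tau>"
    using coprime by (simp add: transl_eq_aff scal_eq_aff aff_mult)
  from stabilizer_decomposition[folded this] show ?thesis
    unfolding sieve_group M_def[symmetric] .
qed

end
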